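(* Let $\nu\in\mathbb{C}$ with $\mathrm{Re}(\nu)>-1$. Then the Hankel transform $\mathcal{H}_{\nu}$ maps $S_{\nu}([0,\infty))$ into itself.
   Context: $S([0,\infty))$ is the space of functions $f_1:[0,\infty)\to\mathbb{C}$ that are smooth on $[0,\infty)$ (one-sided at $0$) and such that $f_1$ and all its derivatives are rapidly decreasing at $\infty$. For $\mathrm{Re}(\nu)>-1$, $S_{\nu}([0,\infty))=\{f:[0,\infty)\to\mathbb{C} : f(x)=x^{1/2+\nu/2}f_1(x),\ f_1\in S([0,\infty))\}$. For $x>0$, $J_{\nu}(x)=\sum_{k=0}^{\infty}\frac{(-1)^k(x/2)^{\nu+2k}}{\Gamma(k+1)\Gamma(k+\nu+1)}$. The Hankel transform of order $\nu$ is $\mathcal{H}_{\nu}(f)(y)=\int_{0}^{\infty}f(x)\sqrt{xy}\,J_{\nu}(2\sqrt{xy})\,\frac{dx}{x}$ for $y>0$, with value at $y=0$ given by continuity (it is $0$). *)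

theory Defs
  imports "HOL-Analysis.Analysis"
begin

text \<open>
  A function on \<open>[0,\<infinity>)\<close> is represented by a total function on \<^typ>\<open>real\<close> whose values on
  negative arguments are irrelevant: all derivatives are taken within \<^term>\<open>{0::real..}\<close>, so
  they are one-sided at \<open>0\<close>, and membership in the spaces below depends only on the
  restriction to \<^term>\<open>{0::real..}\<close>.
\<close>

primrec halfline_deriv :: "nat \<Rightarrow> (real \<Rightarrow> complex) \<Rightarrow> real \<Rightarrow> complex" where
  "halfline_deriv 0 f = f"
| "halfline_deriv (Suc n) f =
     (\<lambda>x. vector_derivative (halfline_deriv n f) (at x within {0..}))"

definition smooth_halfline :: "(real \<Rightarrow> complex) \<Rightarrow> bool" where
  "smooth_halfline f \<longleftrightarrow> (\<forall>n. halfline_deriv n f differentiable_on {0..})"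

definition rapidly_decreasing :: "(real \<Rightarrow> complex) \<Rightarrow> bool" where
  "rapidly_decreasing f \<longleftrightarrow> (\<forall>m::nat. ((\<lambda>x. of_real (x ^ m) * f x) \<longlongrightarrow> 0) at_top)"

definition schwartz_halfline :: "(real \<Rightarrow> complex) set" where
  "schwartz_halfline =
     {f. smooth_halfline f \<and> (\<forall>n. rapidly_decreasing (halfline_deriv n f))}"

text \<open>
  At \<open>x = 0\<close> the factor \<open>x powr (1/2 + \<nu>/2)\<close> is \<open>0\<close>, which is its limit value since
  \<open>Re \<nu> > -1\<close> in all uses.
\<close>

definition schwartz_nu :: "complex \<Rightarrow> (real \<Rightarrow> complex) set" where
  "schwartz_nu \<nu> =
     {f. \<exists>f1\<in>schwartz_halfline. \<forall>x\<ge>0. f x = of_real x powr (1/2 + \<nu>/2) * f1 x}"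

definition bessel_J :: "complex \<Rightarrow> real \<Rightarrow> complex" where
  "bessel_J \<nu> x =
     (\<Sum>k. (-1) ^ k * of_real (x / 2) powr (\<nu> + 2 * of_nat k)
            / (Gamma (of_nat k + 1) * Gamma (of_nat k + \<nu> + 1)))"

definition hankel_integrand :: "complex \<Rightarrow> (real \<Rightarrow> complex) \<Rightarrow> real \<Rightarrow> real \<Rightarrow> complex" where
  "hankel_integrand \<nu> f y x =
     f x * of_real (sqrt (x * y)) * bessel_J \<nu> (2 * sqrt (x * y)) / of_real x"

text \<open>
  The value at \<open>y = 0\<close> is the continuous extension.  That \<open>0\<close> is indeed the limit as
  \<open>y \<rightarrow> 0\<close> is implied by membership of the transform in \<^term>\<open>schwartz_nu \<nu>\<close>, whose elements
  are continuous on \<open>[0,\<infinity>)\<close> and vanish at \<open>0\<close> when \<open>Re \<nu> > -1\<close>.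
\<close>

definition hankel :: "complex \<Rightarrow> (real \<Rightarrow> complex) \<Rightarrow> real \<Rightarrow> complex" where
  "hankel \<nu> f y =
     (if y = 0 then 0 else (LINT x:{0<..}|lborel. hankel_integrand \<nu> f y x))"

end

theory Submission
  imports Defs
begin

text \<open>
  Write \<open>J\<^sub>\<nu>(2\<surd>t) = t\<^bsup>\<nu>/2\<^esup> E\<^sub>\<nu>(t)\<close> with the entire function
  \<open>E\<^sub>\<nu>(z) = \<Sum>k. (-z)\<^sup>k / (k! \<Gamma>(k + \<nu> + 1))\<close>.  The claim becomes that
  \<open>G\<^sub>\<nu> h (y) = \<integral> x\<^sup>\<nu> E\<^sub>\<nu>(x y) h(x) dx\<close> preserves the Schwartz space of the half-line.
  Since \<open>E\<^sub>\<nu>' = -E\<^bsub>\<nu>+1\<^esub>\<close>, one has \<open>(G\<^sub>\<nu> h)' = -G\<^bsub>\<nu>+1\<^esub> h\<close>, so smoothness is automatic and it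
  suffices that every \<open>G\<^sub>\<nu> h\<close> decays rapidly.  Since \<open>(x\<^bsup>\<nu>+1\<^esup> E\<^bsub>\<nu>+1\<^esub>(x y))' = x\<^sup>\<nu> E\<^sub>\<nu>(x y)\<close>,
  integration by parts gives \<open>G\<^sub>\<nu> h = G\<^bsub>\<nu>+2j\<^esub> h\<^bsup>(2j)\<^esup>\<close>, and
  \<open>t\<^sup>j E\<^bsub>\<nu>+2j\<^esub>(t)\<close> grows at most linearly, whence \<open>y\<^sup>j G\<^sub>\<nu> h (y) = O(1 + y)\<close> for all \<open>j\<close>.
  The growth bound comes from the energy \<open>|E\<^sub>\<nu>(t)|\<^sup>2 + t |E\<^bsub>\<nu>+1\<^esub>(t)|\<^sup>2\<close>, which is nonincreasing for
  \<open>Re \<nu> \<ge> -1/2\<close>, and the recurrence \<open>t E\<^bsub>\<nu>+2\<^esub> = (\<nu> + 1) E\<^bsub>\<nu>+1\<^esub> - E\<^sub>\<nu>\<close>.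
\<close>

section \<open>The Bessel-Clifford function: power series, derivative, recurrence\<close>

text \<open>
  With \<^const>\<open>rGamma\<close> (entire, zero at the poles of \<^const>\<open>Gamma\<close>) the identities below hold for all \<open>\<nu>\<close>.
  In terms of the Bessel-Clifford function \<open>C\<^sub>\<nu>\<close>, \<open>bessel_clifford \<nu> z\<close> is \<open>C\<^sub>\<nu>(-z)\<close>.
\<close>

definition clifford_coeff :: "complex \<Rightarrow> nat \<Rightarrow> complex" where
  "clifford_coeff \<nu> k = (-1) ^ k * rGamma (of_nat k + \<nu> + 1) / fact k"

definition bessel_clifford :: "complex \<Rightarrow> complex \<Rightarrow> complex" where
  "bessel_clifford \<nu> z = (\<Sum>k. clifford_coeff \<nu> k * z ^ k)"

text \<open>The functional equation of \<open>rGamma\<close> in the form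
  \<open>z * rGamma (z + 1) = rGamma z\<close>, which also holds at the poles of
  \<open>Gamma\<close>.\<close>

lemma clifford_coeff_add_1:
  "(of_nat k + \<nu> + 1) * clifford_coeff (\<nu> + 1) k = clifford_coeff \<nu> k"
  using rGamma_plus1[of "of_nat k + \<nu> + 1"]
  by (simp add: clifford_coeff_def algebra_simps)

text \<open>Differentiation trades an index shift for an order shift: \<open>Suc k\<close> cancels
  in the factorial, and the argument of \<open>rGamma\<close> at \<open>Suc k\<close> is the one for
  order \<open>\<nu> + 1\<close> at \<open>k\<close>.\<close>

lemma diffs_clifford_coeff: "diffs (clifford_coeff \<nu>) k = - clifford_coeff (\<nu> + 1) k"
proof -
  have "fact (Suc k) = (of_nat (Suc k) :: complex) * fact k"
    by simp
  then show ?thesis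
    by (simp add: diffs_def clifford_coeff_def field_simps del: of_nat_Suc fact_Suc)
       (simp add: algebra_simps)
qed

text \<open>Ratio test. The two preceding identities compare coefficient \<open>Suc k\<close> of
  order \<open>\<nu>\<close> with coefficient \<open>k\<close> of order \<open>\<nu> + 1\<close>,
  and that one with coefficient \<open>k\<close> of order \<open>\<nu>\<close>.\<close>

lemma summable_bessel_clifford: "summable (\<lambda>k. clifford_coeff \<nu> k * z ^ k)"
proof (rule summable_ratio_test)
  \<comment> \<open>The part \<open>cmod \<nu>\<close> makes the factor
    \<open>of_nat k + \<nu> + 1\<close> at least 1 in modulus; the part \<open>2 * cmod z\<close>
    yields the ratio 1/2.\<close>
  define N where "N = nat \<lceil>2 * cmod z + cmod \<nu> + 2\<rceil>"
  show "(1/2 :: real) < 1" by simp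
  fix k assume k: "N \<le> k"
  then have kN: "real k \<ge> 2 * cmod z + cmod \<nu> + 2"
    unfolding N_def by linarith
  have "real k + 1 - cmod \<nu> \<le> cmod (of_nat k + \<nu> + 1)"
    using norm_triangle_ineq2[of "of_nat (Suc k) :: complex" "-\<nu>"]
    unfolding norm_of_nat by (simp add: algebra_simps)
  then have ge1: "1 \<le> cmod (of_nat k + \<nu> + 1)"
    using kN norm_ge_zero[of z] by linarith
  have "cmod (clifford_coeff (\<nu> + 1) k) \<le> cmod (of_nat k + \<nu> + 1) * cmod (clifford_coeff (\<nu> + 1) k)"
    using ge1 by (simp add: mult_le_cancel_right1)
  also have "\<dots> = cmod (clifford_coeff \<nu> k)"
    by (simp flip: clifford_coeff_add_1[of k \<nu>] norm_mult)
  finally have le: "cmod (clifford_coeff (\<nu> + 1) k) \<le> cmod (clifford_coeff \<nu> k)" .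
  have "of_nat (Suc k) * clifford_coeff \<nu> (Suc k) = - clifford_coeff (\<nu> + 1) k"
    using diffs_clifford_coeff[of \<nu> k] by (simp add: diffs_def)
  then have "real (Suc k) * cmod (clifford_coeff \<nu> (Suc k)) = cmod (clifford_coeff (\<nu> + 1) k)"
    by (metis norm_minus_cancel norm_mult norm_of_nat)
  then have suc: "real (Suc k) * cmod (clifford_coeff \<nu> (Suc k)) \<le> cmod (clifford_coeff \<nu> k)"
    using le by simp
  have "2 * cmod z * cmod (clifford_coeff \<nu> (Suc k)) \<le> real (Suc k) * cmod (clifford_coeff \<nu> (Suc k))"
    using kN norm_ge_zero[of \<nu>] by (intro mult_right_mono; linarith?) auto
  also note suc
  finally have "2 * cmod z * cmod (clifford_coeff \<nu> (Suc k)) * cmod z ^ k \<le> cmod (clifford_coeff \<nu> k) * cmod z ^ k"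
    by (intro mult_right_mono) auto
  then show "norm (clifford_coeff \<nu> (Suc k) * z ^ Suc k) \<le> 1/2 * norm (clifford_coeff \<nu> k * z ^ k)"
    by (simp add: norm_mult norm_power mult_ac)
qed

lemma has_field_derivative_bessel_clifford:
  "(bessel_clifford \<nu> has_field_derivative - bessel_clifford (\<nu> + 1) z) (at z)"
proof -
  have "((\<lambda>z. \<Sum>k. clifford_coeff \<nu> k * z ^ k) has_field_derivative
          (\<Sum>k. diffs (clifford_coeff \<nu>) k * z ^ k)) (at z)"
    by (rule termdiffs_strong_converges_everywhere[OF summable_bessel_clifford])
  then show ?thesis
    unfolding bessel_clifford_def[abs_def] diffs_clifford_coeff
    by (simp add: suminf_minus[OF summable_bessel_clifford])
qed

text \<open>Split the factor \<open>of_nat k + \<nu> + 1\<close> of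
  \<open>clifford_coeff_add_1\<close> into \<open>\<nu> + 1\<close> and \<open>k\<close>; the
  \<open>k\<close> part is z times the derivative of the series of order
  \<open>\<nu> + 1\<close>.\<close>

lemma bessel_clifford_recurrence:
  "bessel_clifford \<nu> z = (\<nu> + 1) * bessel_clifford (\<nu> + 1) z - z * bessel_clifford (\<nu> + 2) z"
proof -
  have 1: "(\<lambda>k. (\<nu> + 1) * (clifford_coeff (\<nu> + 1) k * z ^ k)) sums ((\<nu> + 1) * bessel_clifford (\<nu> + 1) z)"
    unfolding bessel_clifford_def by (intro sums_mult summable_sums summable_bessel_clifford)
  have "(\<lambda>k. (- z) * (clifford_coeff (\<nu> + 2) k * z ^ k)) sums ((- z) * bessel_clifford (\<nu> + 2) z)"
    unfolding bessel_clifford_def by (intro sums_mult summable_sums summable_bessel_clifford)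
  moreover have "(- z) * (clifford_coeff (\<nu> + 2) k * z ^ k)
      = of_nat (Suc k) * clifford_coeff (\<nu> + 1) (Suc k) * z ^ Suc k" for k
    using diffs_clifford_coeff[of "\<nu> + 1" k] by (simp add: diffs_def add.assoc)
  ultimately have "(\<lambda>k. of_nat (Suc k) * clifford_coeff (\<nu> + 1) (Suc k) * z ^ Suc k)
      sums ((- z) * bessel_clifford (\<nu> + 2) z)"
    by (simp only:)
  \<comment> \<open>The index is shifted down by one; the new term at 0 vanishes because of its
    factor \<open>k\<close>.\<close>
  then have 2: "(\<lambda>k. of_nat k * clifford_coeff (\<nu> + 1) k * z ^ k) sums ((- z) * bessel_clifford (\<nu> + 2) z)"
    using sums_Suc_iff[of "\<lambda>k. of_nat k * clifford_coeff (\<nu> + 1) k * z ^ k"] by simp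
  have "(\<lambda>k. clifford_coeff \<nu> k * z ^ k) sums
      ((\<nu> + 1) * bessel_clifford (\<nu> + 1) z + (- z) * bessel_clifford (\<nu> + 2) z)"
    using sums_add[OF 1 2] by (simp add: algebra_simps flip: clifford_coeff_add_1[of _ \<nu>])
  then show ?thesis
    unfolding bessel_clifford_def[of \<nu>] using sums_unique by fastforce
qed

lemma has_vector_derivative_bessel_clifford:
  "((\<lambda>t. bessel_clifford \<nu> (of_real t)) has_vector_derivative
     - bessel_clifford (\<nu> + 1) (of_real t)) (at t within S)"
  using has_field_derivative_bessel_clifford
  by (rule has_vector_derivative_real_field)

lemma continuous_on_bessel_clifford [continuous_intros]:
  assumes "continuous_on S g"
  shows "continuous_on S (\<lambda>x. bessel_clifford \<nu> (g x))"
proof -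
  have "continuous_on UNIV (bessel_clifford \<nu>)"
    using has_field_derivative_bessel_clifford
    by (intro continuous_at_imp_continuous_on ballI) (rule DERIV_isCont)
  then show ?thesis
    by (rule continuous_on_compose2) (use assms in auto)
qed

section \<open>Growth on the half-line\<close>

text \<open>Let a, b, c be the values at orders \<open>\<nu>\<close>, \<open>\<nu> + 1\<close>,
  \<open>\<nu> + 2\<close>. The derivative is -2 Re(a conj b) + |b|^2 - 2 Re(b conj(t c)). Inserting
  t c = (\<nu> + 1) b - a cancels the mixed terms, and Im \<nu> drops out.\<close>

lemma has_real_derivative_bessel_clifford_energy:
  "((\<lambda>t. (cmod (bessel_clifford \<nu> (of_real t)))\<^sup>2 + t * (cmod (bessel_clifford (\<nu> + 1) (of_real t)))\<^sup>2)
     has_real_derivative - (2 * Re \<nu> + 1) * (cmod (bessel_clifford (\<nu> + 1) (of_real t)))\<^sup>2) (at t)"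
proof -
  have "((\<lambda>t. Re (bessel_clifford \<mu> (of_real t))) has_real_derivative
          - Re (bessel_clifford (\<mu> + 1) (of_real t))) (at t)" for \<mu>
    using has_field_derivative_Re[OF has_vector_derivative_bessel_clifford[of \<mu>]] by simp
  note [derivative_intros] = this
  have "((\<lambda>t. Im (bessel_clifford \<mu> (of_real t))) has_real_derivative
          - Im (bessel_clifford (\<mu> + 1) (of_real t))) (at t)" for \<mu>
    using has_field_derivative_Im[OF has_vector_derivative_bessel_clifford[of \<mu>]] by simp
  note [derivative_intros] = this
  note rec = bessel_clifford_recurrence[of \<nu> "of_real t"]
  have r: "t * Re (bessel_clifford (\<nu> + 2) t) = (Re \<nu> + 1) * Re (bessel_clifford (\<nu> + 1) t)
        - Im \<nu> * Im (bessel_clifford (\<nu> + 1) t) - Re (bessel_clifford \<nu> t)"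
    using arg_cong[OF rec, of Re] by simp
  have i: "t * Im (bessel_clifford (\<nu> + 2) t) = (Re \<nu> + 1) * Im (bessel_clifford (\<nu> + 1) t)
        + Im \<nu> * Re (bessel_clifford (\<nu> + 1) t) - Im (bessel_clifford \<nu> t)"
    using arg_cong[OF rec, of Im] by simp
  \<comment> \<open>The same cancellation in real coordinates, with index 1 for real and 2 for
    imaginary parts.\<close>
  have alg: "- 2 * (a1 * b1 + a2 * b2) + (b1\<^sup>2 + b2\<^sup>2) - 2 * (b1 * (t * c1) + b2 * (t * c2))
      = - (2 * Re \<nu> + 1) * (b1\<^sup>2 + b2\<^sup>2)"
    if "t * c1 = (Re \<nu> + 1) * b1 - Im \<nu> * b2 - a1" "t * c2 = (Re \<nu> + 1) * b2 + Im \<nu> * b1 - a2"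
    for a1 a2 b1 b2 c1 c2
    unfolding that by (simp add: algebra_simps power2_eq_square)
  show ?thesis
    unfolding cmod_power2
    by (rule derivative_eq_intros refl)+
      (use alg[OF r i] in \<open>simp add: algebra_simps add.assoc power2_eq_square\<close>)
qed

text \<open>The energy is nonincreasing for these orders, and at 0 its second summand
  vanishes.\<close>

lemma bounded_bessel_clifford:
  assumes "Re \<nu> \<ge> -1/2" "t \<ge> 0"
  shows "cmod (bessel_clifford \<nu> (of_real t)) \<le> cmod (bessel_clifford \<nu> 0)"
proof -
  define e where "e t = (cmod (bessel_clifford \<nu> (of_real t)))\<^sup>2
      + t * (cmod (bessel_clifford (\<nu> + 1) (of_real t)))\<^sup>2" for t
  have "e t \<le> e 0"
  proof (rule DERIV_nonpos_imp_nonincreasing[OF \<open>t \<ge> 0\<close>])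
    fix x
    have "- (2 * Re \<nu> + 1) * (cmod (bessel_clifford (\<nu> + 1) (of_real x)))\<^sup>2 \<le> 0"
      using assms by (intro mult_nonpos_nonneg) auto
    then show "\<exists>y. (e has_real_derivative y) (at x) \<and> y \<le> 0"
      using has_real_derivative_bessel_clifford_energy[of \<nu> x] unfolding e_def by blast
  qed
  moreover have "(cmod (bessel_clifford \<nu> (of_real t)))\<^sup>2 \<le> e t"
    using assms by (simp add: e_def)
  moreover have "e 0 = (cmod (bessel_clifford \<nu> 0))\<^sup>2"
    by (simp add: e_def)
  ultimately have "(cmod (bessel_clifford \<nu> (of_real t)))\<^sup>2 \<le> (cmod (bessel_clifford \<nu> 0))\<^sup>2"
    by linarith
  then show ?thesis
    using power2_le_imp_le norm_ge_zero by blast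
qed

text \<open>Each raising of the order by 2 gains one power of t. The linear factor arises for j = 0:
  the energy bound may fail at \<open>\<nu>\<close> itself when Re \<nu> < -1/2, so the recurrence
  is used to pass to orders \<open>\<nu> + 1\<close> and \<open>\<nu> + 2\<close>, where it
  applies.\<close>

lemma bessel_clifford_decay:
  assumes "Re \<nu> > -1"
  obtains C where "C \<ge> 0"
    "\<And>t. t \<ge> 0 \<Longrightarrow> t ^ j * cmod (bessel_clifford (\<nu> + of_nat (2 * j)) (of_real t)) \<le> C * (1 + t)"
proof -
  let ?E = "\<lambda>\<mu> t. cmod (bessel_clifford \<mu> (complex_of_real t))"
  have "\<exists>C\<ge>0. \<forall>t\<ge>0. t ^ j * ?E (\<nu> + of_nat (2 * j)) t \<le> C * (1 + t)"
    using assms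
  proof (induction j arbitrary: \<nu>)
    case 0
    define C where "C = cmod (\<nu> + 1) * ?E (\<nu> + 1) 0 + ?E (\<nu> + 2) 0"
    have "?E \<nu> t \<le> C * (1 + t)" if "t \<ge> 0" for t
    proof -
      have "?E \<nu> t \<le> cmod (\<nu> + 1) * ?E (\<nu> + 1) t + t * ?E (\<nu> + 2) t"
        using that norm_triangle_ineq4[of "(\<nu> + 1) * bessel_clifford (\<nu> + 1) t" "t * bessel_clifford (\<nu> + 2) t"]
        by (subst bessel_clifford_recurrence) (simp add: norm_mult)
      also have "\<dots> \<le> cmod (\<nu> + 1) * ?E (\<nu> + 1) 0 + t * ?E (\<nu> + 2) 0"
        using 0 that bounded_bessel_clifford[of "\<nu> + 1" t] bounded_bessel_clifford[of "\<nu> + 2" t]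
        by (intro add_mono mult_left_mono) auto
      also have "\<dots> \<le> C * (1 + t)"
        using that by (simp add: C_def algebra_simps)
      finally show ?thesis .
    qed
    moreover have "C \<ge> 0" by (simp add: C_def)
    ultimately show ?case by auto
  next
    case (Suc j)
    obtain C1 where C1: "C1 \<ge> 0" "\<And>t. t \<ge> 0 \<Longrightarrow> t ^ j * ?E (\<nu> + of_nat (2 * j)) t \<le> C1 * (1 + t)"
      using Suc.IH[OF Suc.prems] by auto
    have "Re (\<nu> + 1) > -1" using Suc.prems by simp
    from Suc.IH[OF this] obtain C2 where
      C2: "C2 \<ge> 0" "\<And>t. t \<ge> 0 \<Longrightarrow> t ^ j * ?E (\<nu> + 1 + of_nat (2 * j)) t \<le> C2 * (1 + t)"
      by auto
    \<comment> \<open>The recurrence at \<open>\<mu>\<close> involves the orders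
      \<open>\<mu>\<close> and \<open>\<mu> + 1\<close>, so the induction hypothesis is used for
      both \<open>\<nu>\<close> and \<open>\<nu> + 1\<close>.\<close>
    define \<mu> where "\<mu> = \<nu> + of_nat (2 * j)"
    define C where "C = cmod (\<mu> + 1) * C2 + C1"
    have "t ^ Suc j * ?E (\<mu> + 2) t \<le> C * (1 + t)" if "t \<ge> 0" for t
    proof -
      have "of_real t * bessel_clifford (\<mu> + 2) t
          = (\<mu> + 1) * bessel_clifford (\<mu> + 1) t - bessel_clifford \<mu> t"
        by (subst bessel_clifford_recurrence[of \<mu>]) simp
      then have "t * ?E (\<mu> + 2) t = cmod ((\<mu> + 1) * bessel_clifford (\<mu> + 1) t - bessel_clifford \<mu> t)"
        using that by (metis abs_of_nonneg norm_mult norm_of_real)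
      also have "\<dots> \<le> cmod (\<mu> + 1) * ?E (\<mu> + 1) t + ?E \<mu> t"
        by (metis norm_triangle_ineq4 norm_mult)
      finally have "t ^ j * (t * ?E (\<mu> + 2) t) \<le> t ^ j * (cmod (\<mu> + 1) * ?E (\<mu> + 1) t + ?E \<mu> t)"
        using that by (intro mult_left_mono) auto
      also have "\<dots> = cmod (\<mu> + 1) * (t ^ j * ?E (\<nu> + 1 + of_nat (2 * j)) t) + t ^ j * ?E (\<nu> + of_nat (2 * j)) t"
        by (simp add: \<mu>_def algebra_simps)
      also have "\<dots> \<le> cmod (\<mu> + 1) * (C2 * (1 + t)) + C1 * (1 + t)"
        using that C1 C2 by (intro add_mono mult_left_mono) auto
      finally show ?thesis
        by (simp add: C_def algebra_simps)
    qed
    moreover have "\<mu> + 2 = \<nu> + of_nat (2 * Suc j)"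
      by (simp add: \<mu>_def)
    moreover have "C \<ge> 0" using C1 C2 by (simp add: C_def)
    ultimately show ?case by metis
  qed
  then show thesis using that by blast
qed

section \<open>Link with the Bessel function\<close>

text \<open>Termwise comparison. At a pole of \<open>Gamma\<close> the quotient in
  \<open>bessel_J\<close> is 0 by the convention for division by 0, in agreement with
  \<open>rGamma\<close>.\<close>

lemma bessel_J_eq_bessel_clifford:
  assumes "t > 0"
  shows "bessel_J \<nu> (2 * sqrt t) = of_real t powr (\<nu>/2) * bessel_clifford \<nu> (of_real t)"
proof -
  have "(-1) ^ k * of_real (2 * sqrt t / 2) powr (\<nu> + 2 * of_nat k)
            / (Gamma (of_nat k + 1) * Gamma (of_nat k + \<nu> + 1))
      = of_real t powr (\<nu>/2) * (clifford_coeff \<nu> k * of_real t ^ k)" for k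
  proof -
    have s: "complex_of_real (sqrt t) = of_real t powr (1/2)"
      using assms powr_of_real[of t "1/2"] by (simp add: powr_half_sqrt)
    have "of_real (2 * sqrt t / 2) powr (\<nu> + 2 * of_nat k)
        = of_real (sqrt t) powr \<nu> * (of_real (sqrt t) powr of_nat (2 * k))"
      by (simp add: powr_add)
    also have "of_real (sqrt t) powr of_nat (2 * k) = (complex_of_real t) ^ k"
      using assms by (subst powr_nat') (auto simp: power_mult simp flip: of_real_power)
    also have "of_real (sqrt t) powr \<nu> = complex_of_real t powr (\<nu> / 2)"
      using assms by (simp add: powr_def Ln_of_real ln_sqrt)
    finally have "of_real (2 * sqrt t / 2) powr (\<nu> + 2 * of_nat k)
        = complex_of_real t powr (\<nu> / 2) * (complex_of_real t) ^ k" .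
    moreover have "Gamma (of_nat k + 1 :: complex) = fact k"
      using Gamma_fact[of k] by (simp add: add.commute)
    ultimately show ?thesis
      by (simp add: clifford_coeff_def rGamma_inverse_Gamma field_simps)
  qed
  then show ?thesis
    unfolding bessel_J_def bessel_clifford_def
    by (simp only: suminf_mult[OF summable_bessel_clifford])
qed

section \<open>Iterated derivatives and Schwartz functions on the half-line\<close>

text \<open>Makes derivatives within the half-line unique, including the one-sided derivative at
  0.\<close>

lemma at_within_halfline_nontrivial: "x \<ge> 0 \<Longrightarrow> at x within {0::real..} \<noteq> bot"
  using at_le[of "{x<..}" "{0..}" x] trivial_limit_at_right_real[of x]
  by (force simp: bot_unique)

text \<open>Identifies \<open>halfline_deriv\<close>, defined by choosing derivatives, with an
  explicit sequence. Agreement on \<open>{0..}\<close> suffices because all derivatives are taken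
  within that set.\<close>

lemma halfline_deriv_eqI:
  assumes D: "\<And>n x. x \<ge> 0 \<Longrightarrow> (D n has_vector_derivative D (Suc n) x) (at x within {0..})"
    and f: "\<And>x. x \<ge> 0 \<Longrightarrow> f x = D 0 x" and "x \<ge> 0"
  shows "halfline_deriv n f x = D n x"
  using \<open>x \<ge> 0\<close>
proof (induction n arbitrary: x)
  case 0
  then show ?case using f by simp
next
  case (Suc n)
  have "(halfline_deriv n f has_vector_derivative D (Suc n) x) (at x within {0..})"
    by (rule has_vector_derivative_transform[OF _ _ D]) (use Suc in auto)
  then show ?case
    using vector_derivative_within[OF at_within_halfline_nontrivial] Suc.prems by simp
qed

lemma schwartz_halflineI:
  assumes D: "\<And>n x. x \<ge> 0 \<Longrightarrow> (D n has_vector_derivative D (Suc n) x) (at x within {0..})"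
    and f: "\<And>x. x \<ge> 0 \<Longrightarrow> f x = D 0 x" and rd: "\<And>n. rapidly_decreasing (D n)"
  shows "f \<in> schwartz_halfline"
proof -
  have eq: "halfline_deriv n f x = D n x" if "x \<ge> 0" for n x
    using halfline_deriv_eqI[OF D f that] .
  have "(halfline_deriv n f has_vector_derivative D (Suc n) x) (at x within {0..})" if "x \<ge> 0" for n x
    by (rule has_vector_derivative_transform[OF _ _ D]) (use that eq in auto)
  then have "smooth_halfline f"
    unfolding smooth_halfline_def differentiable_on_def
    by (auto intro: differentiableI_vector)
  moreover have "rapidly_decreasing (halfline_deriv n f)" for n
    unfolding rapidly_decreasing_def
  proof
    fix m
    have "((\<lambda>x. of_real (x ^ m) * D n x) \<longlongrightarrow> 0) at_top"
      using rd by (simp add: rapidly_decreasing_def)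
    then show "((\<lambda>x. of_real (x ^ m) * halfline_deriv n f x) \<longlongrightarrow> 0) at_top"
      by (rule Lim_transform_eventually)
        (use eventually_ge_at_top[of "0::real"] in eventually_elim, simp add: eq)
  qed
  ultimately show ?thesis by (simp add: schwartz_halfline_def)
qed

lemma schwartz_halflineD:
  assumes "f \<in> schwartz_halfline"
  shows "rapidly_decreasing (halfline_deriv n f)"
    and "x \<ge> 0 \<Longrightarrow> (halfline_deriv n f has_vector_derivative halfline_deriv (Suc n) f x) (at x within {0..})"
    and "continuous_on {0..} (halfline_deriv n f)"
  using assms
  by (auto simp: schwartz_halfline_def smooth_halfline_def differentiable_on_def
      simp flip: vector_derivative_works intro!: differentiable_imp_continuous_on)

section \<open>Rapid decay and integrability\<close>

lemma rapidly_decreasing_powr: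
  assumes "rapidly_decreasing h"
  shows "((\<lambda>x. x powr a * cmod (h x)) \<longlongrightarrow> 0) at_top"
proof -
  define m where "m = nat \<lceil>a\<rceil>"
  have "((\<lambda>x. of_real (x ^ m) * h x) \<longlongrightarrow> 0) at_top"
    using assms by (simp add: rapidly_decreasing_def)
  then show ?thesis
  proof (rule Lim_null_comparison[OF _ tendsto_norm_zero, rotated])
    show "\<forall>\<^sub>F x in at_top. norm (x powr a * cmod (h x)) \<le> cmod (of_real (x ^ m) * h x)"
      using eventually_ge_at_top[of "1::real"]
    proof eventually_elim
      case (elim x)
      have "x powr a \<le> x powr real m"
        using elim by (intro powr_mono) (auto simp: m_def real_nat_ceiling_ge)
      also have "\<dots> = x ^ m"
        using elim by (simp add: powr_realpow)
      finally show ?case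
        using elim by (simp add: norm_mult norm_power mult_right_mono)
    qed
  qed
qed

lemma set_borel_measurable_lborel_continuous:
  fixes f :: "real \<Rightarrow> 'a::real_normed_vector"
  assumes "A \<in> sets borel" "continuous_on A f"
  shows "set_borel_measurable lborel A f"
  unfolding set_borel_measurable_def
  using borel_measurable_continuous_on_indicator[OF assms] by simp

text \<open>Split at a large K: on \<open>{0<..K}\<close> h is bounded and \<open>x powr a\<close>
  is integrable since a > -1; on \<open>{K..}\<close> decay of h gives domination by
  \<open>x powr (-2)\<close>.\<close>

lemma set_integrable_powr_rapidly_decreasing:
  assumes cont: "continuous_on {0..} h" and rd: "rapidly_decreasing h" and a: "a > -1"
  shows "set_integrable lborel {0<..} (\<lambda>x. x powr a * cmod (h x))"
proof -
  have "((\<lambda>x. x powr (a + 2) * cmod (h x)) \<longlongrightarrow> 0) at_top"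
    by (rule rapidly_decreasing_powr[OF rd])
  then have "\<forall>\<^sub>F x in at_top. x powr (a + 2) * cmod (h x) < 1"
    by (rule order_tendstoD) simp
  then obtain K0 where K0: "\<And>x. x \<ge> K0 \<Longrightarrow> x powr (a + 2) * cmod (h x) < 1"
    by (auto simp: eventually_at_top_linorder)
  \<comment> \<open>The maximum with 1 keeps K positive, so that the two pieces cover exactly
    \<open>{0<..}\<close>.\<close>
  define K where "K = max K0 1"
  have K: "K \<ge> 1" "\<And>x. x \<ge> K \<Longrightarrow> x powr (a + 2) * cmod (h x) < 1"
    using K0 by (auto simp: K_def)
  have "bounded (h ` {0..K})"
    by (intro compact_imp_bounded compact_continuous_image continuous_on_subset[OF cont]) auto
  then obtain B where B: "\<And>x. x \<in> {0..K} \<Longrightarrow> cmod (h x) \<le> B"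
    unfolding bounded_iff by blast
  have meas: "set_borel_measurable lborel A (\<lambda>x. x powr a * cmod (h x))"
    if "A \<subseteq> {0<..}" "A \<in> sets borel" for A
  proof (rule set_borel_measurable_lborel_continuous[OF that(2)])
    have "continuous_on A h"
      by (rule continuous_on_subset[OF cont]) (use that in auto)
    then show "continuous_on A (\<lambda>x. x powr a * cmod (h x))"
      using that by (intro continuous_intros) auto
  qed
  \<comment> \<open>For nonnegative integrands gauge integrability gives Lebesgue integrability;
    Borel measurability brings it from the completed measure back to \<open>lborel\<close>.\<close>
  have lborel: "set_integrable lborel A g"
    if "g integrable_on A" "\<And>x. x \<in> A \<Longrightarrow> 0 \<le> g x" "set_borel_measurable lborel A g" for A and g :: "real \<Rightarrow> real"
    using nonnegative_absolutely_integrable_1[OF that(1,2)] that(3)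
    unfolding set_integrable_def set_borel_measurable_def by (simp add: integrable_completion)
  have "set_integrable lborel {0<..K} (\<lambda>x. x powr a)"
  proof (rule lborel)
    show "(\<lambda>x. x powr a) integrable_on {0<..K}"
      by (rule integrable_on_powr_from_0') (use a K in auto)
  qed (auto simp: set_borel_measurable_def)
  then have "set_integrable lborel {0<..K} (\<lambda>x. B * x powr a)"
    by simp
  then have 1: "set_integrable lborel {0<..K} (\<lambda>x. x powr a * cmod (h x))"
  proof (rule set_integrable_bound)
    show "AE x in lborel. x \<in> {0<..K} \<longrightarrow> norm (x powr a * cmod (h x)) \<le> norm (B * x powr a)"
    proof (intro AE_I2 impI)
      fix x assume "x \<in> {0<..K}"
      then have "cmod (h x) \<le> \<bar>B\<bar>" using B[of x] by auto
      then show "norm (x powr a * cmod (h x)) \<le> norm (B * x powr a)"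
        by (simp add: abs_mult mult.commute mult_right_mono)
    qed
  qed (rule meas; auto)
  have "set_integrable lborel {K..} (\<lambda>x. x powr (-2))"
  proof (rule lborel)
    show "(\<lambda>x. x powr (-2)) integrable_on {K..}"
      using has_integral_powr_to_inf[of "-2" K] K by (auto simp: integrable_on_def)
  qed (auto simp: set_borel_measurable_def)
  then have 2: "set_integrable lborel {K..} (\<lambda>x. x powr a * cmod (h x))"
  proof (rule set_integrable_bound)
    show "AE x in lborel. x \<in> {K..} \<longrightarrow> norm (x powr a * cmod (h x)) \<le> norm (x powr (-2))"
    proof (intro AE_I2 impI)
      fix x assume x: "x \<in> {K..}"
      have "x powr a = x powr (-2) * x powr (a + 2)"
        by (simp flip: powr_add)
      then have "x powr a * cmod (h x) = x powr (-2) * (x powr (a + 2) * cmod (h x))"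
        by (simp only: mult.assoc)
      also have "\<dots> \<le> x powr (-2) * 1"
        using x K(2)[of x] by (intro mult_left_mono) auto
      finally show "norm (x powr a * cmod (h x)) \<le> norm (x powr (-2))"
        by simp
    qed
  qed (rule meas; use K in auto)
  have "{0<..K} \<union> {K..} = {0<..}" using K by auto
  with set_integrable_Un[OF 1 2] show ?thesis by simp
qed

section \<open>The core transform and its derivative\<close>

text \<open>This is \<open>G\<^sub>\<nu>\<close> of the overview: the Hankel transform with the
  factor \<open>y powr (1/2 + \<nu>/2)\<close> removed from the output and its analogue in x from
  the input.\<close>

definition hankel_core :: "complex \<Rightarrow> (real \<Rightarrow> complex) \<Rightarrow> real \<Rightarrow> complex" where
  "hankel_core \<nu> h y =
     (LINT x:{0<..}|lborel. of_real x powr \<nu> * bessel_clifford \<nu> (of_real (x * y)) * h x)"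

text \<open>The linear growth bound (the case j = 0 of \<open>bessel_clifford_decay\<close>) leaves
  two integrands of the form \<open>x powr a * cmod (h x)\<close> with a > -1.\<close>

lemma set_integrable_hankel_core:
  assumes h: "continuous_on {0..} h" "rapidly_decreasing h" and \<nu>: "Re \<nu> > -1" and "y \<ge> 0"
  shows "set_integrable lborel {0<..}
           (\<lambda>x. of_real x powr \<nu> * bessel_clifford \<nu> (of_real (x * y)) * h x)"
proof -
  obtain C where C: "C \<ge> 0" "\<And>t. t \<ge> 0 \<Longrightarrow> cmod (bessel_clifford \<nu> (of_real t)) \<le> C * (1 + t)"
    using bessel_clifford_decay[OF \<nu>, of 0] by auto
  have "set_integrable lborel {0<..} (\<lambda>x. C * (x powr Re \<nu> * cmod (h x)) + C * y * (x powr (Re \<nu> + 1) * cmod (h x)))"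
    using set_integrable_powr_rapidly_decreasing[OF h, of "Re \<nu>"]
      set_integrable_powr_rapidly_decreasing[OF h, of "Re \<nu> + 1"] \<nu>
    by (intro set_integral_add set_integrable_mult_right) auto
  then show ?thesis
  proof (rule set_integrable_bound)
    show "set_borel_measurable lborel {0<..} (\<lambda>x. of_real x powr \<nu> * bessel_clifford \<nu> (of_real (x * y)) * h x)"
    proof (rule set_borel_measurable_lborel_continuous)
      have "continuous_on {0<..} h"
        by (rule continuous_on_subset[OF h(1)]) auto
      then show "continuous_on {0<..} (\<lambda>x. of_real x powr \<nu> * bessel_clifford \<nu> (of_real (x * y)) * h x)"
        by (intro continuous_intros) auto
    qed auto
    show "AE x in lborel. x \<in> {0<..} \<longrightarrow> norm (of_real x powr \<nu> * bessel_clifford \<nu> (of_real (x * y)) * h x)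
        \<le> norm (C * (x powr Re \<nu> * cmod (h x)) + C * y * (x powr (Re \<nu> + 1) * cmod (h x)))"
    proof (intro AE_I2 impI)
      fix x :: real assume "x \<in> {0<..}"
      then have x: "x > 0" by simp
      have "norm (of_real x powr \<nu> * bessel_clifford \<nu> (of_real (x * y)) * h x)
          = x powr Re \<nu> * cmod (bessel_clifford \<nu> (of_real (x * y))) * cmod (h x)"
        using x by (simp add: norm_mult norm_powr_real_powr)
      also have "\<dots> \<le> x powr Re \<nu> * (C * (1 + x * y)) * cmod (h x)"
        using C(2)[of "x * y"] x \<open>y \<ge> 0\<close> by (intro mult_right_mono mult_left_mono) auto
      also have "\<dots> = C * (x powr Re \<nu> * cmod (h x)) + C * y * (x powr (Re \<nu> + 1) * cmod (h x))"
        using x by (simp add: powr_add algebra_simps)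
      also have "\<dots> \<le> norm \<dots>" by simp
      finally show "norm (of_real x powr \<nu> * bessel_clifford \<nu> (of_real (x * y)) * h x)
        \<le> norm (C * (x powr Re \<nu> * cmod (h x)) + C * y * (x powr (Re \<nu> + 1) * cmod (h x)))" .
    qed
  qed
qed

lemma norm_set_integral_le:
  fixes f :: "'a::euclidean_space \<Rightarrow> 'b::{banach, second_countable_topology}"
  assumes "set_integrable M A f" "set_integrable M A g"
    and "\<And>x. x \<in> A \<Longrightarrow> norm (f x) \<le> g x"
  shows "norm (LINT x:A|M. f x) \<le> (LINT x:A|M. g x)"
  unfolding set_lebesgue_integral_def
  by (rule Bochner_Integration.integral_norm_bound_integral)
    (use assms in \<open>auto simp: set_integrable_def split: split_indicator\<close>)

text \<open>The second derivative is the function of order \<open>\<nu> + 2\<close>, bounded by its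
  value at 0. Hence the first derivative is Lipschitz, and linearization along the segment from t to
  s gives the quadratic remainder.\<close>

lemma bessel_clifford_Taylor_bound:
  assumes "Re \<nu> > -1" "s \<ge> 0" "t \<ge> 0"
  shows "cmod (bessel_clifford \<nu> (of_real s) - bessel_clifford \<nu> (of_real t)
           + of_real (s - t) * bessel_clifford (\<nu> + 1) (of_real t))
         \<le> cmod (bessel_clifford (\<nu> + 2) 0) * (s - t)\<^sup>2"
proof -
  let ?M = "cmod (bessel_clifford (\<nu> + 2) 0)"
  have lip: "cmod (bessel_clifford (\<nu> + 1) (of_real u) - bessel_clifford (\<nu> + 1) (of_real t)) \<le> ?M * \<bar>u - t\<bar>"
    if "u \<ge> 0" for u
  proof -
    have "norm (bessel_clifford (\<nu> + 1) (of_real u) - bessel_clifford (\<nu> + 1) (of_real t)) \<le> ?M * norm (u - t)"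
    proof (rule differentiable_bound[where S = "{0..}"])
      show "((\<lambda>t. bessel_clifford (\<nu> + 1) (of_real t)) has_derivative
              (\<lambda>h. h *\<^sub>R (- bessel_clifford (\<nu> + 1 + 1) (of_real x)))) (at x within {0..})" for x
        using has_vector_derivative_bessel_clifford unfolding has_vector_derivative_def .
      show "onorm (\<lambda>h. h *\<^sub>R (- bessel_clifford (\<nu> + 1 + 1) (of_real x))) \<le> ?M" if "x \<in> {0..}" for x :: real
        using bounded_bessel_clifford[of "\<nu> + 2" x] assms that
        by (intro onorm_le) (auto simp: add.assoc mult.commute mult_left_mono)
    qed (use that assms in auto)
    then show ?thesis by simp
  qed
  have seg: "u \<ge> 0" "\<bar>u - t\<bar> \<le> \<bar>s - t\<bar>" if "u \<in> closed_segment t s" for u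
    using that assms by (auto simp: closed_segment_eq_real_ivl split: if_splits)
  have "norm (bessel_clifford \<nu> (of_real s) - bessel_clifford \<nu> (of_real t)
      - (s - t) *\<^sub>R (- bessel_clifford (\<nu> + 1) (of_real t))) \<le> norm (s - t) * (?M * \<bar>s - t\<bar>)"
  proof (rule vector_differentiable_bound_linearization[where S = "closed_segment t s" and ?x0.0 = t])
    show "((\<lambda>t. bessel_clifford \<nu> (of_real t)) has_vector_derivative
              - bessel_clifford (\<nu> + 1) (of_real x)) (at x within closed_segment t s)" for x
      by (rule has_vector_derivative_bessel_clifford)
    show "norm (- bessel_clifford (\<nu> + 1) (of_real x) - - bessel_clifford (\<nu> + 1) (of_real t)) \<le> ?M * \<bar>s - t\<bar>"
      if "x \<in> closed_segment t s" for x
    proof -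
      have "norm (- bessel_clifford (\<nu> + 1) (of_real x) - - bessel_clifford (\<nu> + 1) (of_real t)) \<le> ?M * \<bar>x - t\<bar>"
        using lip[OF seg(1)[OF that]] by (simp add: norm_minus_commute)
      also have "\<dots> \<le> ?M * \<bar>s - t\<bar>"
        using seg(2)[OF that] by (intro mult_left_mono) auto
      finally show ?thesis .
    qed
  qed auto
  then show ?thesis
    by (simp add: scaleR_conv_of_real power2_eq_square mult_ac flip: abs_mult)
qed

lemma has_vector_derivative_quadratic_bound:
  fixes f :: "real \<Rightarrow> 'a::real_normed_vector"
  assumes "\<And>z. z \<in> S \<Longrightarrow> norm (f z - f y - (z - y) *\<^sub>R d) \<le> K * (z - y)\<^sup>2"
  shows "(f has_vector_derivative d) (at y within S)"
  unfolding has_vector_derivative_def has_derivative_within_alt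
proof (intro conjI allI impI bounded_linear_scaleR_left)
  fix e :: real assume e: "e > 0"
  show "\<exists>\<delta>>0. \<forall>z\<in>S. norm (z - y) < \<delta> \<longrightarrow> norm (f z - f y - (z - y) *\<^sub>R d) \<le> e * norm (z - y)"
  \<comment> \<open>This radius forces |K| |z - y| \<le> e; the added 1 covers K = 0.\<close>
  proof (intro exI[of _ "e / (\<bar>K\<bar> + 1)"] conjI ballI impI)
    fix z assume z: "z \<in> S" "norm (z - y) < e / (\<bar>K\<bar> + 1)"
    have "\<bar>K\<bar> * \<bar>z - y\<bar> \<le> (\<bar>K\<bar> + 1) * \<bar>z - y\<bar>"
      by (intro mult_right_mono) auto
    also have "\<dots> \<le> e"
      using z by (simp add: field_simps)
    finally have *: "\<bar>K\<bar> * \<bar>z - y\<bar> \<le> e" .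
    have "norm (f z - f y - (z - y) *\<^sub>R d) \<le> K * (z - y)\<^sup>2"
      using assms z by blast
    also have "\<dots> \<le> \<bar>K\<bar> * (z - y)\<^sup>2"
      by (intro mult_right_mono) auto
    also have "\<dots> = (\<bar>K\<bar> * \<bar>z - y\<bar>) * \<bar>z - y\<bar>"
      by (simp add: power2_eq_square mult.assoc)
    also have "\<dots> \<le> e * \<bar>z - y\<bar>"
      using * by (intro mult_right_mono) auto
    finally show "norm (f z - f y - (z - y) *\<^sub>R d) \<le> e * norm (z - y)" by simp
  qed (use e in auto)
qed

text \<open>Differentiation under the integral through an explicit remainder: the Taylor bound at
  \<open>x * z\<close> and \<open>x * y\<close> is integrated in x. The remainder contributes a
  factor x^2, hence the integrable weight \<open>x powr (Re \<nu> + 2)\<close>. The endpoint y = 0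
  is included.\<close>

lemma has_vector_derivative_hankel_core:
  assumes h: "continuous_on {0..} h" "rapidly_decreasing h" and \<nu>: "Re \<nu> > -1" and "y \<ge> 0"
  shows "(hankel_core \<nu> h has_vector_derivative - hankel_core (\<nu> + 1) h y) (at y within {0..})"
proof (rule has_vector_derivative_quadratic_bound)
  let ?M = "cmod (bessel_clifford (\<nu> + 2) 0)"
  let ?I = "LINT x:{0<..}|lborel. x powr (Re \<nu> + 2) * cmod (h x)"
  let ?F = "\<lambda>\<nu> y x. of_real x powr \<nu> * bessel_clifford \<nu> (of_real (x * y)) * h x"
  fix z :: real assume "z \<in> {0..}"
  then have "z \<ge> 0" by simp
  have int: "set_integrable lborel {0<..} (?F \<nu> z)" "set_integrable lborel {0<..} (?F \<nu> y)"
    "set_integrable lborel {0<..} (\<lambda>x. of_real (z - y) * ?F (\<nu> + 1) y x)"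
    by (intro set_integrable_mult_right set_integrable_hankel_core h;
        use \<nu> \<open>y \<ge> 0\<close> \<open>z \<ge> 0\<close> in simp)+
  have diff: "hankel_core \<nu> h z - hankel_core \<nu> h y - (z - y) *\<^sub>R (- hankel_core (\<nu> + 1) h y)
      = (LINT x:{0<..}|lborel. ?F \<nu> z x - ?F \<nu> y x + of_real (z - y) * ?F (\<nu> + 1) y x)"
    unfolding hankel_core_def scaleR_conv_of_real
    using int by (simp only: set_integral_diff set_integral_add set_integral_mult_right) simp
  have bound: "cmod (LINT x:{0<..}|lborel. ?F \<nu> z x - ?F \<nu> y x + of_real (z - y) * ?F (\<nu> + 1) y x)
      \<le> (LINT x:{0<..}|lborel. (?M * (z - y)\<^sup>2) * (x powr (Re \<nu> + 2) * cmod (h x)))"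
  proof (rule norm_set_integral_le)
    show "set_integrable lborel {0<..} (\<lambda>x. ?F \<nu> z x - ?F \<nu> y x + of_real (z - y) * ?F (\<nu> + 1) y x)"
      by (intro set_integral_add set_integral_diff int)
    show "set_integrable lborel {0<..} (\<lambda>x. (?M * (z - y)\<^sup>2) * (x powr (Re \<nu> + 2) * cmod (h x)))"
      by (intro set_integrable_mult_right set_integrable_powr_rapidly_decreasing h) (use \<nu> in simp)
    fix x :: real assume "x \<in> {0<..}"
    then have x: "x > 0" by simp
    have "?F \<nu> z x - ?F \<nu> y x + of_real (z - y) * ?F (\<nu> + 1) y x
        = of_real x powr \<nu> * (bessel_clifford \<nu> (of_real (x * z)) - bessel_clifford \<nu> (of_real (x * y))
            + of_real (x * z - x * y) * bessel_clifford (\<nu> + 1) (of_real (x * y))) * h x"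
      using x by (simp add: powr_add algebra_simps)
    also have "cmod \<dots> \<le> x powr Re \<nu> * (?M * (x * z - x * y)\<^sup>2) * cmod (h x)"
      unfolding norm_mult
      using bessel_clifford_Taylor_bound[OF \<nu>, of "x * z" "x * y"] x \<open>y \<ge> 0\<close> \<open>z \<ge> 0\<close>
      by (intro mult_right_mono mult_mono) (auto simp: norm_powr_real_powr)
    also have "\<dots> = (?M * (z - y)\<^sup>2) * (x powr (Re \<nu> + 2) * cmod (h x))"
      using x by (simp add: powr_add power2_eq_square algebra_simps)
    finally show "cmod (?F \<nu> z x - ?F \<nu> y x + of_real (z - y) * ?F (\<nu> + 1) y x)
        \<le> (?M * (z - y)\<^sup>2) * (x powr (Re \<nu> + 2) * cmod (h x))" .
  qed
  show "cmod (hankel_core \<nu> h z - hankel_core \<nu> h y - (z - y) *\<^sub>R (- hankel_core (\<nu> + 1) h y))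
      \<le> (?M * ?I) * (z - y)\<^sup>2"
    unfolding diff using bound unfolding set_integral_mult_right by (simp only: mult_ac)
qed

section \<open>Integration by parts\<close>

text \<open>The product rule gives two terms, which are \<open>x powr \<nu>\<close> times the right
  side of the recurrence at \<open>x * y\<close>.\<close>

lemma has_vector_derivative_powr_bessel_clifford:
  assumes "x > 0"
  shows "((\<lambda>x. of_real x powr (\<nu> + 1) * bessel_clifford (\<nu> + 1) (of_real (x * y)))
           has_vector_derivative of_real x powr \<nu> * bessel_clifford \<nu> (of_real (x * y))) (at x)"
proof -
  have "((\<lambda>z. z powr (\<nu> + 1) * bessel_clifford (\<nu> + 1) (z * of_real y)) has_field_derivative
      (\<nu> + 1) * of_real x powr (\<nu> + 1 - 1) * bessel_clifford (\<nu> + 1) (of_real x * of_real y)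
      + - bessel_clifford (\<nu> + 1 + 1) (of_real x * of_real y) * of_real y * of_real x powr (\<nu> + 1)) (at (of_real x))"
    using assms
    by (intro DERIV_mult has_field_derivative_powr
        DERIV_chain2[OF has_field_derivative_bessel_clifford] DERIV_cmult_right[OF DERIV_ident, of "of_real y", simplified]) auto
  then have "((\<lambda>x. of_real x powr (\<nu> + 1) * bessel_clifford (\<nu> + 1) (of_real x * of_real y))
      has_vector_derivative
      (\<nu> + 1) * of_real x powr (\<nu> + 1 - 1) * bessel_clifford (\<nu> + 1) (of_real x * of_real y)
      + - bessel_clifford (\<nu> + 1 + 1) (of_real x * of_real y) * of_real y * of_real x powr (\<nu> + 1)) (at x)"
    by (rule has_vector_derivative_real_field)
  moreover have "(\<nu> + 1) * of_real x powr (\<nu> + 1 - 1) * bessel_clifford (\<nu> + 1) (of_real x * of_real y)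
      + - bessel_clifford (\<nu> + 1 + 1) (of_real x * of_real y) * of_real y * of_real x powr (\<nu> + 1)
      = of_real x powr \<nu> * bessel_clifford \<nu> (of_real x * of_real y)"
    using assms by (subst (3) bessel_clifford_recurrence) (simp add: powr_add algebra_simps)
  ultimately show ?thesis by simp
qed

text \<open>The product \<open>F\<close> is an antiderivative of the sum of both integrands. Its
  boundary values vanish: at 0 because Re \<nu> + 1 > 0, at infinity because h decays
  rapidly.\<close>

lemma hankel_core_by_parts:
  assumes h: "continuous_on {0..} h" "rapidly_decreasing h"
    and h': "continuous_on {0..} h'" "rapidly_decreasing h'"
    and D: "\<And>x. x \<ge> 0 \<Longrightarrow> (h has_vector_derivative h' x) (at x within {0..})"
    and \<nu>: "Re \<nu> > -1" and "y \<ge> 0"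
  shows "hankel_core \<nu> h y = - hankel_core (\<nu> + 1) h' y"
proof -
  define F where "F x = of_real x powr (\<nu> + 1) * bessel_clifford (\<nu> + 1) (of_real (x * y)) * h x" for x
  define f1 where "f1 x = of_real x powr \<nu> * bessel_clifford \<nu> (of_real (x * y)) * h x" for x
  define f2 where "f2 x = of_real x powr (\<nu> + 1) * bessel_clifford (\<nu> + 1) (of_real (x * y)) * h' x" for x
  have int: "set_integrable lborel {0<..} f1" "set_integrable lborel {0<..} f2"
    unfolding f1_def[abs_def] f2_def[abs_def] using \<nu> \<open>y \<ge> 0\<close>
    by (auto intro!: set_integrable_hankel_core h h' simp del: of_real_mult)
  \<comment> \<open>The order \<open>\<nu> + 1\<close> has positive real part, so the uniform energy
    bound applies.\<close>
  have F_le: "cmod (F x) \<le> cmod (bessel_clifford (\<nu> + 1) 0) * (x powr (Re \<nu> + 1) * cmod (h x))"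
    if "x > 0" for x
  proof -
    have "cmod (F x) = x powr (Re \<nu> + 1) * cmod (bessel_clifford (\<nu> + 1) (of_real (x * y))) * cmod (h x)"
      using that by (simp add: F_def norm_mult norm_powr_real_powr)
    also have "\<dots> \<le> x powr (Re \<nu> + 1) * cmod (bessel_clifford (\<nu> + 1) 0) * cmod (h x)"
      using bounded_bessel_clifford[of "\<nu> + 1" "x * y"] that \<nu> \<open>y \<ge> 0\<close>
      by (intro mult_right_mono mult_left_mono) auto
    finally show ?thesis by (simp add: mult_ac)
  qed
  have "(LBINT x=0..\<infinity>. f1 x + f2 x) = 0 - 0"
  proof (rule interval_integral_FTC_integrable)
    fix x assume "0 < ereal x"
    then have x: "x > 0" by simp
    have "at x within {0..} = at x"
      using x by (intro at_within_interior) simp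
    then have "(h has_vector_derivative h' x) (at x)"
      using D[of x] x by simp
    then have "(F has_vector_derivative
        (of_real x powr (\<nu> + 1) * bessel_clifford (\<nu> + 1) (of_real (x * y))) * h' x
        + (of_real x powr \<nu> * bessel_clifford \<nu> (of_real (x * y))) * h x) (at x)"
      unfolding F_def[abs_def]
      by (intro has_vector_derivative_mult has_vector_derivative_powr_bessel_clifford x)
    then show "(F has_vector_derivative f1 x + f2 x) (at x)"
      by (simp add: f1_def f2_def add.commute)
    have "continuous_on {0<..} (\<lambda>x. f1 x + f2 x)"
      unfolding f1_def f2_def
      by (intro continuous_intros continuous_on_subset[OF h(1)] continuous_on_subset[OF h'(1)]) auto
    then show "isCont (\<lambda>x. f1 x + f2 x) x"
      using x by (intro continuous_on_interior[of "{0<..}"]) (auto simp: interior_open)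
  next
    show "set_integrable lborel (einterval 0 \<infinity>) (\<lambda>x. f1 x + f2 x)"
      using set_integral_add(1)[OF int] by (simp add: einterval_eq_Ici[of 0, unfolded zero_ereal_def[symmetric]])
    have "bounded (h ` {0..1})"
      by (intro compact_imp_bounded compact_continuous_image continuous_on_subset[OF h(1)]) auto
    then obtain B where B: "\<And>x. x \<in> {0..1} \<Longrightarrow> cmod (h x) \<le> B"
      unfolding bounded_iff by blast
    have "(F \<longlongrightarrow> 0) (at_right 0)"
    proof (rule Lim_null_comparison)
      let ?C = "cmod (bessel_clifford (\<nu> + 1) 0)"
      show "\<forall>\<^sub>F x in at_right 0. norm (F x) \<le> ?C * (x powr (Re \<nu> + 1) * B)"
      proof (rule eventually_at_rightI[of 0 1])
        fix x :: real assume x: "x \<in> {0<..<1}"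
        have "cmod (F x) \<le> ?C * (x powr (Re \<nu> + 1) * cmod (h x))"
          using F_le x by simp
        also have "\<dots> \<le> ?C * (x powr (Re \<nu> + 1) * B)"
          using B[of x] x by (intro mult_left_mono) auto
        finally show "cmod (F x) \<le> ?C * (x powr (Re \<nu> + 1) * B)" .
      qed simp
      have "((\<lambda>x. x powr (Re \<nu> + 1)) \<longlongrightarrow> 0 powr (Re \<nu> + 1)) (at_right (0::real))"
        using \<nu> by (intro tendsto_powr' tendsto_intros)
          (auto intro: eventually_at_rightI[of 0 1])
      then show "((\<lambda>x. ?C * (x powr (Re \<nu> + 1) * B)) \<longlongrightarrow> 0) (at_right 0)"
        by (intro tendsto_mult_right_zero tendsto_mult_left_zero) simp
    qed
    then show "((F \<circ> real_of_ereal) \<longlongrightarrow> 0) (at_right 0)"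
      by (simp add: zero_ereal_def ereal_tendsto_simps1)
    have "(F \<longlongrightarrow> 0) at_top"
    proof (rule Lim_null_comparison)
      let ?C = "cmod (bessel_clifford (\<nu> + 1) 0)"
      show "\<forall>\<^sub>F x in at_top. norm (F x) \<le> ?C * (x powr (Re \<nu> + 1) * cmod (h x))"
        using eventually_gt_at_top[of 0] by (rule eventually_mono) (rule F_le)
      show "((\<lambda>x. ?C * (x powr (Re \<nu> + 1) * cmod (h x))) \<longlongrightarrow> 0) at_top"
        by (intro tendsto_mult_right_zero rapidly_decreasing_powr h)
    qed
    then show "((F \<circ> real_of_ereal) \<longlongrightarrow> 0) (at_left \<infinity>)"
      by (simp add: ereal_tendsto_simps1)
  qed simp
  then have "(LINT x:{0<..}|lborel. f1 x + f2 x) = 0"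
    by (simp add: interval_lebesgue_integral_0_infty)
  then have "(LINT x:{0<..}|lborel. f1 x) + (LINT x:{0<..}|lborel. f2 x) = 0"
    using set_integral_add(2)[OF int] by simp
  then show ?thesis
    unfolding hankel_core_def f1_def f2_def by (simp add: eq_neg_iff_add_eq_0)
qed

lemma hankel_core_iterated_parts:
  assumes f: "f \<in> schwartz_halfline" and \<nu>: "Re \<nu> > -1" and "y \<ge> 0"
  shows "hankel_core \<nu> f y = (-1) ^ m * hankel_core (\<nu> + of_nat m) (halfline_deriv m f) y"
proof (induction m)
  case (Suc m)
  have "hankel_core (\<nu> + of_nat m) (halfline_deriv m f) y
      = - hankel_core (\<nu> + of_nat m + 1) (halfline_deriv (Suc m) f) y"
    by (rule hankel_core_by_parts)
      (use schwartz_halflineD[OF f] \<nu> \<open>y \<ge> 0\<close> in \<open>auto simp del: halfline_deriv.simps\<close>)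
  with Suc show ?case by (simp add: add_ac)
qed simp

section \<open>Rapid decay and smoothness of the core transform\<close>

text \<open>Integrate by parts 2j times, an even number, so the sign disappears. Of the extra weight
  x^(2j), one half joins y^j to form (x y)^j, which \<open>bessel_clifford_decay\<close> absorbs;
  the other half stays with the 2j-th derivative of f.\<close>

lemma hankel_core_bound:
  assumes f: "f \<in> schwartz_halfline" and \<nu>: "Re \<nu> > -1"
  obtains K where "\<And>y. y \<ge> 0 \<Longrightarrow> y ^ j * cmod (hankel_core \<nu> f y) \<le> K * (1 + y)"
proof -
  let ?g = "halfline_deriv (2 * j) f" and ?\<mu> = "\<nu> + of_nat (2 * j)"
  note g = schwartz_halflineD(3,1)[OF f, of "2 * j"]
  obtain C where C: "C \<ge> 0"
    "\<And>t. t \<ge> 0 \<Longrightarrow> t ^ j * cmod (bessel_clifford ?\<mu> (of_real t)) \<le> C * (1 + t)"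
    using bessel_clifford_decay[OF \<nu>, of j] by blast
  define I where "I a = (LINT x:{0<..}|lborel. x powr a * cmod (?g x))" for a
  have int: "set_integrable lborel {0<..} (\<lambda>x. x powr a * cmod (?g x))" if "a > -1" for a
    by (rule set_integrable_powr_rapidly_decreasing[OF g that])
  have I: "I a \<ge> 0" for a
    unfolding I_def set_lebesgue_integral_def by (rule integral_nonneg_AE) simp
  have "y ^ j * cmod (hankel_core \<nu> f y) \<le> (C * (I (Re \<nu> + j) + I (Re \<nu> + j + 1))) * (1 + y)" if "y \<ge> 0" for y
  proof -
    let ?a = "Re \<nu> + j"
    let ?F = "\<lambda>x. of_real x powr ?\<mu> * bessel_clifford ?\<mu> (of_real (x * y)) * ?g x"
    let ?G = "\<lambda>x. C * (x powr ?a * cmod (?g x)) + C * y * (x powr (?a + 1) * cmod (?g x))"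
    have "y ^ j * cmod (hankel_core \<nu> f y) = cmod (of_real (y ^ j) * hankel_core ?\<mu> ?g y)"
      using that by (subst hankel_core_iterated_parts[OF f \<nu> that, of "2 * j"]) (simp add: norm_mult norm_power)
    also have "\<dots> = cmod (LINT x:{0<..}|lborel. of_real (y ^ j) * ?F x)"
      unfolding hankel_core_def by simp
    also have "\<dots> \<le> (LINT x:{0<..}|lborel. ?G x)"
    proof (rule norm_set_integral_le)
      show "set_integrable lborel {0<..} (\<lambda>x. of_real (y ^ j) * ?F x)"
        by (intro set_integrable_mult_right set_integrable_hankel_core g) (use \<nu> that in auto)
      show "set_integrable lborel {0<..} ?G"
        by (intro set_integral_add set_integrable_mult_right int) (use \<nu> in auto)
      fix x :: real assume "x \<in> {0<..}"
      then have x: "x > 0" by simp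
      have "x powr Re ?\<mu> = x powr (?a + real j)"
        by (simp add: add.assoc)
      also have "\<dots> = x powr ?a * x ^ j"
        using x by (subst powr_add) (simp add: powr_realpow)
      finally have "cmod (of_real (y ^ j) * ?F x)
          = x powr ?a * ((x * y) ^ j * cmod (bessel_clifford ?\<mu> (of_real (x * y)))) * cmod (?g x)"
        using x that by (simp add: norm_mult norm_power norm_powr_real_powr power_mult_distrib mult_ac)
      also have "\<dots> \<le> x powr ?a * (C * (1 + x * y)) * cmod (?g x)"
        using C(2)[of "x * y"] x that by (intro mult_right_mono mult_left_mono) auto
      also have "\<dots> = ?G x"
        using x by (simp add: powr_add algebra_simps)
      finally show "cmod (of_real (y ^ j) * ?F x) \<le> ?G x" .
    qed
    also have "\<dots> = C * I ?a + C * y * I (?a + 1)"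
      unfolding I_def using int[of ?a] int[of "?a + 1"] \<nu> by (subst set_integral_add) auto
    \<comment> \<open>The missing cross terms are nonnegative, since C, y and the integrals
      are.\<close>
    also have "\<dots> \<le> (C * (I ?a + I (?a + 1))) * (1 + y)"
      using that C(1) I by (simp add: algebra_simps)
    finally show ?thesis .
  qed
  then show thesis by (rule that)
qed

lemma rapidly_decreasing_hankel_core:
  assumes f: "f \<in> schwartz_halfline" and \<nu>: "Re \<nu> > -1"
  shows "rapidly_decreasing (hankel_core \<nu> f)"
  unfolding rapidly_decreasing_def
proof
  fix m
  \<comment> \<open>Two powers beyond m outweigh the linear factor \<open>1 + y\<close>.\<close>
  obtain K where K: "\<And>y. y \<ge> 0 \<Longrightarrow> y ^ (m + 2) * cmod (hankel_core \<nu> f y) \<le> K * (1 + y)"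
    using hankel_core_bound[OF f \<nu>] by blast
  show "((\<lambda>y. of_real (y ^ m) * hankel_core \<nu> f y) \<longlongrightarrow> 0) at_top"
  proof (rule Lim_null_comparison)
    show "\<forall>\<^sub>F y in at_top. norm (of_real (y ^ m) * hankel_core \<nu> f y) \<le> K * ((1 + y) / y\<^sup>2)"
      using eventually_gt_at_top[of 0]
    proof eventually_elim
      case (elim y)
      then show ?case
        using K[of y] by (simp add: norm_mult norm_power power_add power2_eq_square field_simps)
    qed
    have "((\<lambda>y::real. (1 + y) / y\<^sup>2) \<longlongrightarrow> 0) at_top"
    proof (rule Lim_transform_eventually)
      show "((\<lambda>y::real. inverse y * inverse y + inverse y) \<longlongrightarrow> 0) at_top"
        using tendsto_add[OF tendsto_mult[OF tendsto_inverse_0_at_top tendsto_inverse_0_at_top] tendsto_inverse_0_at_top,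
            of "\<lambda>y. y" at_top "\<lambda>y. y" "\<lambda>y. y"] by (simp add: filterlim_ident)
      show "\<forall>\<^sub>F y::real in at_top. inverse y * inverse y + inverse y = (1 + y) / y\<^sup>2"
        using eventually_gt_at_top[of 0] by eventually_elim (simp add: field_simps power2_eq_square)
    qed
    then show "((\<lambda>y. K * ((1 + y) / y\<^sup>2)) \<longlongrightarrow> 0) at_top"
      by (rule tendsto_mult_right_zero)
  qed
qed

text \<open>The n-th derivative is (-1)^n times the core transform of order
  \<open>\<nu> + of_nat n\<close> of the same f, so the decay result applied at each order covers
  all derivatives.\<close>

lemma hankel_core_in_schwartz_halfline:
  assumes f: "f \<in> schwartz_halfline" and \<nu>: "Re \<nu> > -1"
  shows "hankel_core \<nu> f \<in> schwartz_halfline"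
proof (rule schwartz_halflineI)
  fix n
  have \<nu>n: "Re (\<nu> + of_nat n) > -1" using \<nu> by simp
  show "((\<lambda>y. (-1) ^ n * hankel_core (\<nu> + of_nat n) f y) has_vector_derivative
          (-1) ^ Suc n * hankel_core (\<nu> + of_nat (Suc n)) f x) (at x within {0..})"
    if "x \<ge> 0" for x
    using has_vector_derivative_mult_right[OF has_vector_derivative_hankel_core[OF _ _ \<nu>n that], of f "(-1) ^ n"]
      schwartz_halflineD[OF f, of 0] by (simp add: add_ac)
  show "rapidly_decreasing (\<lambda>y. (-1) ^ n * hankel_core (\<nu> + of_nat n) f y)"
    unfolding rapidly_decreasing_def
  proof
    fix m
    have "((\<lambda>y. of_real (y ^ m) * hankel_core (\<nu> + of_nat n) f y) \<longlongrightarrow> 0) at_top"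
      using rapidly_decreasing_hankel_core[OF f \<nu>n] by (simp add: rapidly_decreasing_def)
    from tendsto_mult_right_zero[OF this, of "(-1) ^ n"]
    show "((\<lambda>y. of_real (y ^ m) * ((-1) ^ n * hankel_core (\<nu> + of_nat n) f y)) \<longlongrightarrow> 0) at_top"
      by (simp add: mult_ac)
  qed
qed simp

section \<open>Return to the Hankel transform\<close>

text \<open>Exponent count: in x the powers 1/2 + \<nu>/2, 1/2 and \<nu>/2 together with the
  division by x give \<nu>; in y the powers 1/2 and \<nu>/2 remain.\<close>

lemma hankel_integrand_eq:
  assumes f: "\<And>x. x \<ge> 0 \<Longrightarrow> f x = of_real x powr (1/2 + \<nu>/2) * f1 x" and "x > 0" "y > 0"
  shows "hankel_integrand \<nu> f y x = of_real y powr (1/2 + \<nu>/2)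
           * (of_real x powr \<nu> * bessel_clifford \<nu> (of_real (x * y)) * f1 x)"
proof -
  have sqrt: "complex_of_real (sqrt t) = of_real t powr (1/2)" if "t > 0" for t
    using that powr_of_real[of t "1/2"] by (simp add: powr_half_sqrt)
  have xy: "complex_of_real (x * y) powr z = of_real x powr z * of_real y powr z" for z
    using assms by (simp add: powr_times_real)
  have "complex_of_real x powr \<nu> * of_real x
      = of_real x powr (1/2 + \<nu>/2) * of_real x powr (1/2) * of_real x powr (\<nu>/2)"
  proof -
    have "\<nu> + 1 = 1/2 + \<nu>/2 + 1/2 + \<nu>/2"
      by (simp add: field_simps)
    then have "complex_of_real x powr \<nu> * of_real x powr 1
      = of_real x powr (1/2 + \<nu>/2) * of_real x powr (1/2) * of_real x powr (\<nu>/2)"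
      by (simp only: powr_add[symmetric])
    then show ?thesis using assms by simp
  qed
  then have x: "complex_of_real x powr \<nu>
      = of_real x powr (1/2 + \<nu>/2) * of_real x powr (1/2) * of_real x powr (\<nu>/2) / of_real x"
    using assms by (simp add: field_simps)
  have y: "complex_of_real y powr (1/2 + \<nu>/2) = of_real y powr (1/2) * of_real y powr (\<nu>/2)"
    by (rule powr_add)
  have J: "bessel_J \<nu> (2 * sqrt (x * y)) = of_real (x * y) powr (\<nu>/2) * bessel_clifford \<nu> (of_real (x * y))"
    using assms by (intro bessel_J_eq_bessel_clifford) simp
  have s: "complex_of_real (sqrt (x * y)) = of_real (x * y) powr (1/2)"
    using assms by (intro sqrt) simp
  show ?thesis
    unfolding hankel_integrand_def J s xy x y using f[of x] assms by (simp add: mult_ac)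
qed

theorem corollary2p2:
  fixes \<nu> :: complex
  assumes "Re \<nu> > -1"
  shows "\<forall>f\<in>schwartz_nu \<nu>.
           (\<forall>y>0. set_integrable lborel {0<..} (hankel_integrand \<nu> f y)) \<and>
           hankel \<nu> f \<in> schwartz_nu \<nu>"
proof
  fix f assume "f \<in> schwartz_nu \<nu>"
  then obtain f1 where f1: "f1 \<in> schwartz_halfline"
    and f: "\<And>x. x \<ge> 0 \<Longrightarrow> f x = of_real x powr (1/2 + \<nu>/2) * f1 x"
    by (auto simp: schwartz_nu_def)
  let ?F = "\<lambda>y x. of_real y powr (1/2 + \<nu>/2) * (of_real x powr \<nu> * bessel_clifford \<nu> (of_real (x * y)) * f1 x)"
  have eq: "\<forall>x\<in>{0<..}. hankel_integrand \<nu> f y x = ?F y x" if "y > 0" for y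
    using hankel_integrand_eq[of f \<nu> f1, OF f] that by auto
  \<comment> \<open>A non-integrable function has Bochner integral 0 by convention; integrability
    ensures that \<open>hankel\<close> is the genuine transform.\<close>
  have "set_integrable lborel {0<..} (hankel_integrand \<nu> f y)" if "y > 0" for y
  proof -
    have "set_integrable lborel {0<..} (?F y)"
      using schwartz_halflineD(1,3)[OF f1, of 0] assms that
      by (intro set_integrable_mult_right set_integrable_hankel_core) auto
    then show ?thesis
      using set_integrable_cong[of lborel lborel "{0<..}" "{0<..}" "hankel_integrand \<nu> f y" "?F y"] eq[OF that] by auto
  qed
  moreover have "hankel \<nu> f y = of_real y powr (1/2 + \<nu>/2) * hankel_core \<nu> f1 y" if "y \<ge> 0" for y
  \<comment> \<open>At y = 0 the left side is 0 by definition and the right side because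
    \<open>0 powr z = 0\<close>.\<close>
  proof (cases "y = 0")
    case False
    with that have "y > 0" by simp
    then have "hankel \<nu> f y = (LINT x:{0<..}|lborel. ?F y x)"
      using eq[OF \<open>y > 0\<close>] by (simp only: hankel_def if_False False) (rule set_lebesgue_integral_cong; simp)
    then show ?thesis by (simp add: hankel_core_def)
  qed (simp add: hankel_def)
  then have "hankel \<nu> f \<in> schwartz_nu \<nu>"
    using hankel_core_in_schwartz_halfline[OF f1 assms] by (auto simp: schwartz_nu_def)
  ultimately show "(\<forall>y>0. set_integrable lborel {0<..} (hankel_integrand \<nu> f y)) \<and> hankel \<nu> f \<in> schwartz_nu \<nu>"
    by blast
qed

end
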